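(* Let $a,b,\alpha,\beta,r$ be positive real constants satisfying $a>b+\alpha$. Let $v:[-r,\infty)\rightarrow\mathbb{R}^{+}$ be a continuous function satisfying $$D^{+}v(t)\leq -a\,v(t)+b\sup_{-r\leq s\leq 0}\{v(t+s)\}+\alpha\|v_0\|_{r}\,e^{-\beta t}\qquad\text{for all } t\in\mathbb{R}^{+},$$ where $\|v_0\|_{r}=\sup_{-r\leq s\leq 0}\{v(s)\}$. Then $$v(t)\leq \|v_0\|_{r}\,e^{-\eta t}\qquad\text{for all } t\in\mathbb{R}^{+},$$ where $\eta=\min\{\lambda,\beta\}$ and $\lambda>0$ is the unique positive solution of the equation $a=be^{\lambda r}+\lambda+\alpha$.
   Context: $\mathbb{R}^{+}=[0,\infty)$ denotes the set of nonnegative real numbers. $D^{+}v(t)$ denotes the upper right-hand Dini derivative of $v$ at $t$, $D^{+}v(t)=\limsup_{h\to 0^{+}}\frac{v(t+h)-v(t)}{h}$, taken in the extended real numbers. *)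

theory Defs
  imports "HOL-Analysis.Analysis"
begin

definition dini_upper_right :: "(real \<Rightarrow> real) \<Rightarrow> real \<Rightarrow> ereal" where
  "dini_upper_right v t = Limsup (at_right 0) (\<lambda>h. ereal ((v (t + h) - v t) / h))"

text \<open>The supremum is taken in the conditionally complete order of the reals; it is the
  intended one whenever \<open>v\<close> is bounded above on \<open>{- r..0}\<close>, e.g. if it is continuous there.\<close>

definition initial_norm :: "real \<Rightarrow> (real \<Rightarrow> real) \<Rightarrow> real" where
  "initial_norm r v = (SUP s\<in>{- r..0}. v s)"

end

theory Submission
  imports Defs
begin

text \<open>For \<open>K > initial_norm r v\<close> the function \<open>\<phi> t = K * exp (- \<eta> * t)\<close> dominates \<open>v\<close>. As long as
  \<open>v \<le> \<phi>\<close> holds up to \<open>t\<close>, a contact \<open>v t = \<phi> t\<close> turns the differential inequality into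
  \<open>D\<^sup>+ v t \<le> K * exp (- \<eta> * t) * (- a + b * exp (\<eta> * r)) + \<alpha> * initial_norm r v * exp (- \<beta> * t)\<close>,
  which is strictly less than \<open>\<phi>' t\<close> because \<open>\<eta> \<le> l\<close>, \<open>\<eta> \<le> \<beta>\<close> and \<open>initial_norm r v < K\<close>.
  Hence \<open>v\<close> cannot cross \<open>\<phi>\<close>; let \<open>K\<close> decrease to \<open>initial_norm r v\<close>.\<close>

text \<open>Consider the infimum \<open>T\<close> of the points where \<open>g\<close> is positive.
  Continuity and \<open>init\<close> force \<open>g T \<le> 0\<close>. To the right of
  \<open>T\<close>, \<open>g\<close> stays nonpositive for a while: by \<open>contact\<close> if
  \<open>g T = 0\<close>, by continuity if \<open>g T < 0\<close>. So \<open>T\<close> is not the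
  infimum.\<close>

lemma nonpos_if_no_upcrossing:
  fixes g :: "real \<Rightarrow> real"
  assumes cont: "continuous_on {0..} g"
    and init: "g 0 \<le> 0"
    and contact: "\<And>t. \<lbrakk>t \<ge> 0; g t = 0; \<And>s. s \<in> {0..t} \<Longrightarrow> g s \<le> 0\<rbrakk>
      \<Longrightarrow> \<forall>\<^sub>F h in at_right 0. g (t + h) \<le> 0"
    and "t \<ge> 0"
  shows "g t \<le> 0"
proof (rule ccontr)
  assume neg: "\<not> g t \<le> 0"
  define B where "B = {t. t \<ge> 0 \<and> g t > 0}"
  define T where "T = Inf B"
  have B_ne: "B \<noteq> {}" using neg \<open>t \<ge> 0\<close> by (auto simp: B_def)
  have bdd: "bdd_below B" by (auto simp: B_def bdd_below_def)
  have T0: "T \<ge> 0" unfolding T_def using B_ne by (intro cInf_greatest) (auto simp: B_def)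
  have before: "g s \<le> 0" if "0 \<le> s" "s < T" for s
  proof (rule ccontr)
    assume "\<not> g s \<le> 0"
    with that have "s \<in> B" by (auto simp: B_def)
    then have "T \<le> s" unfolding T_def using bdd by (rule cInf_lower)
    with that show False by simp
  qed
  have near: "\<exists>d>0. \<forall>s\<ge>0. \<bar>s - T\<bar> < d \<longrightarrow> \<bar>g s - g T\<bar> < e" if "e > 0" for e
    using cont T0 that unfolding continuous_on_iff dist_real_def by (simp add: Ball_def)
  have gT: "g T \<le> 0"
  proof (rule ccontr)
    assume pos: "\<not> g T \<le> 0"
    with init have "T \<noteq> 0" by auto
    with T0 have "T > 0" by simp
    obtain d where d: "d > 0" "\<And>s. s \<ge> 0 \<Longrightarrow> \<bar>s - T\<bar> < d \<Longrightarrow> \<bar>g s - g T\<bar> < g T"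
      using near[of "g T"] pos by auto
    \<comment> \<open>A point to the left of \<open>T\<close>, close enough that
      \<open>g s > 0\<close> by continuity; the \<open>max\<close> keeps it in the domain
      \<open>{0..}\<close>.\<close>
    define s where "s = max 0 (T - d / 2)"
    have "s \<ge> 0" "s < T" "\<bar>s - T\<bar> < d"
      using \<open>T > 0\<close> d(1) by (auto simp: s_def max_def abs_if)
    with d(2)[of s] before[of s] show False by linarith
  qed
  have "\<exists>d>0. \<forall>s. T < s \<and> s < T + d \<longrightarrow> g s \<le> 0"
  proof (cases "g T = 0")
    case True
    have "g s \<le> 0" if "s \<in> {0..T}" for s
      using before[of s] gT that by (cases "s = T") auto
    from contact[OF T0 True this] obtain d
      where "d > 0" and d: "\<And>h. 0 < h \<Longrightarrow> h < d \<Longrightarrow> g (T + h) \<le> 0"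
      unfolding eventually_at_right_field by auto
    have "g s \<le> 0" if "T < s" "s < T + d" for s using d[of "s - T"] that by simp
    with \<open>d > 0\<close> show ?thesis by blast
  next
    case False
    with gT have "- g T > 0" by simp
    from near[OF this] obtain d
      where "d > 0" and d: "\<And>s. s \<ge> 0 \<Longrightarrow> \<bar>s - T\<bar> < d \<Longrightarrow> \<bar>g s - g T\<bar> < - g T"
      by auto
    have "g s \<le> 0" if "T < s" "s < T + d" for s using d[of s] that T0 by auto
    with \<open>d > 0\<close> show ?thesis by blast
  qed
  then obtain d where "d > 0" and d: "\<And>s. T < s \<Longrightarrow> s < T + d \<Longrightarrow> g s \<le> 0" by blast
  have "T + d \<le> s" if "s \<in> B" for s
  proof -
    from that have "g s > 0" by (simp add: B_def)
    moreover have "T \<le> s" unfolding T_def using that bdd by (rule cInf_lower)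
    moreover have "s \<noteq> T" using gT \<open>g s > 0\<close> by auto
    ultimately show ?thesis using d[of s] by (meson leD not_le_imp_less order_le_less)
  qed
  then have "T + d \<le> T" unfolding T_def using B_ne by (intro cInf_greatest)
  with \<open>d > 0\<close> show False by simp
qed

text \<open>A number \<open>c\<close> strictly between \<open>A\<close> and \<open>D\<close>
  separates the right difference quotients: those of \<open>v\<close> are eventually below
  \<open>c\<close>, those of \<open>\<phi>\<close> eventually above. Since both functions agree at
  \<open>t\<close>, comparing quotients compares values.\<close>

lemma below_after_contact:
  assumes dini: "dini_upper_right v t \<le> ereal A" and "A < D"
    and deriv: "(\<phi> has_real_derivative D) (at t)"
    and contact: "v t = \<phi> t"
  shows "\<forall>\<^sub>F h in at_right 0. v (t + h) \<le> \<phi> (t + h)"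
proof -
  obtain c where c: "A < c" "c < D" using dense \<open>A < D\<close> by blast
  have "Limsup (at_right 0) (\<lambda>h. ereal ((v (t + h) - v t) / h)) < ereal c"
    using dini c(1) unfolding dini_upper_right_def by (auto intro: le_less_trans)
  then have 1: "\<forall>\<^sub>F h in at_right 0. (v (t + h) - v t) / h < c"
    by (auto dest: Limsup_lessD)
  have "((\<lambda>h. (\<phi> (t + h) - \<phi> t) / h) \<longlongrightarrow> D) (at_right 0)"
    using deriv unfolding DERIV_def by (rule tendsto_mono[rotated]) (simp add: at_le)
  then have 2: "\<forall>\<^sub>F h in at_right 0. c < (\<phi> (t + h) - \<phi> t) / h"
    using c(2) by (rule order_tendstoD)
  show ?thesis
    using 1 2 eventually_at_right_less
  proof eventually_elim
    case (elim h)
    then have "(v (t + h) - v t) / h < (\<phi> (t + h) - \<phi> t) / h" by linarith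
    with elim contact show ?case by (simp add: divide_less_cancel)
  qed
qed

text \<open>The right-hand side is continuous and strictly increasing in \<open>l\<close>. It equals
  \<open>b + \<alpha> < a\<close> at \<open>0\<close>, and at \<open>l = a\<close> its linear term
  alone already reaches \<open>a\<close>.\<close>

lemma characteristic_root_ex1:
  fixes a b \<alpha> r :: real
  assumes "b > 0" "\<alpha> > 0" "r > 0" "a > b + \<alpha>"
  shows "\<exists>!l::real. l > 0 \<and> a = b * exp (l * r) + l + \<alpha>"
proof -
  define f where "f = (\<lambda>l. b * exp (l * r) + l + \<alpha>)"
  have mono: "f x < f y" if "x < y" for x y
    using assms that unfolding f_def by (intro add_strict_right_mono add_strict_mono) auto
  have "f 0 \<le> a" "a \<le> f a" using assms by (auto simp: f_def)
  moreover have "continuous_on {0..a} f" unfolding f_def by (intro continuous_intros)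
  ultimately obtain l where l: "0 \<le> l" "f l = a" using IVT'[of f 0 a a] assms by auto
  have "l \<noteq> 0" using l assms by (auto simp: f_def)
  show ?thesis
  proof (rule ex1I[of _ l])
    show "l > 0 \<and> a = b * exp (l * r) + l + \<alpha>" using l \<open>l \<noteq> 0\<close> by (auto simp: f_def)
    fix m assume "m > 0 \<and> a = b * exp (m * r) + m + \<alpha>"
    then have "f m = f l" using l by (simp add: f_def)
    then show "m = l" using mono[of m l] mono[of l m] by (cases m l rule: linorder_cases) auto
  qed
qed

lemma le_initial_norm:
  assumes "continuous_on {- r..} v" "s \<in> {- r..0}"
  shows "v s \<le> initial_norm r v"
proof -
  have "continuous_on {- r..0} v"
    using assms(1) by (rule continuous_on_subset) auto
  then have "bdd_above (v ` {- r..0})"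
    by (intro bounded_imp_bdd_above compact_imp_bounded compact_continuous_image) auto
  with assms(2) show ?thesis unfolding initial_norm_def by (rule cSUP_upper)
qed

text \<open>The condition on \<open>\<eta>\<close> is an inequality because
  \<open>min l \<beta>\<close> may lie strictly below the characteristic root.\<close>

lemma halanay_strict_majorant:
  fixes a b \<alpha> \<beta> \<eta> r K :: real and v :: "real \<Rightarrow> real"
  assumes "b > 0" "\<alpha> > 0" "r > 0"
    and cont: "continuous_on {- r..} v"
    and nonneg: "\<And>t. t \<ge> - r \<Longrightarrow> v t \<ge> 0"
    and dini: "\<And>t. t \<ge> 0 \<Longrightarrow>
      dini_upper_right v t \<le>
        ereal (- a * v t + b * (SUP s\<in>{- r..0}. v (t + s))
               + \<alpha> * initial_norm r v * exp (- \<beta> * t))"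
    and \<eta>: "\<eta> \<ge> 0" "\<eta> \<le> \<beta>" "b * exp (\<eta> * r) + \<eta> + \<alpha> \<le> a"
    and K: "initial_norm r v < K"
    and "t \<ge> 0"
  shows "v t \<le> K * exp (- \<eta> * t)"
proof -
  define M where "M = initial_norm r v"
  define \<phi> where "\<phi> = (\<lambda>t. K * exp (- \<eta> * t))"
  note M_ub = le_initial_norm[OF cont, folded M_def]
  have "M \<ge> 0" using M_ub[of 0] nonneg[of 0] \<open>r > 0\<close> by auto
  have "M < K" using K by (simp add: M_def)
  then have "K > 0" using \<open>M \<ge> 0\<close> by simp
  have "v t - \<phi> t \<le> 0"
  proof (rule nonpos_if_no_upcrossing[where g = "\<lambda>t. v t - \<phi> t"])
    show "continuous_on {0..} (\<lambda>t. v t - \<phi> t)"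
      unfolding \<phi>_def using \<open>r > 0\<close>
      by (intro continuous_intros continuous_on_subset[OF cont]) auto
    show "v 0 - \<phi> 0 \<le> 0" using M_ub[of 0] \<open>M < K\<close> \<open>r > 0\<close> by (auto simp: \<phi>_def)
    show "t \<ge> 0" by fact
    fix t :: real
    assume t: "t \<ge> 0" "v t - \<phi> t = 0"
      and up_to: "\<And>s. s \<in> {0..t} \<Longrightarrow> v s - \<phi> s \<le> 0"
    \<comment> \<open>The delay window may reach back before time \<open>0\<close>; there
      \<open>\<phi> u \<ge> K\<close>, which exceeds the initial supremum.\<close>
    have below: "v u \<le> \<phi> u" if "u \<in> {- r..t}" for u
    proof (cases "u \<ge> 0")
      case True
      with up_to[of u] that show ?thesis by auto
    next
      case False
      then have "v u \<le> K" using M_ub[of u] that \<open>M < K\<close> by auto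
      also have "K * 1 \<le> K * exp (- \<eta> * u)"
        using False \<eta>(1) \<open>K > 0\<close>
        by (intro mult_left_mono) (auto simp: mult_nonneg_nonpos)
      finally show ?thesis by (simp add: \<phi>_def)
    qed
    \<comment> \<open>As \<open>\<phi>\<close> is nonincreasing, its largest value on the window is
      at \<open>t - r\<close>, whence the factor \<open>exp (\<eta> * r)\<close>.\<close>
    have sup: "(SUP s\<in>{- r..0}. v (t + s)) \<le> \<phi> t * exp (\<eta> * r)"
    proof (rule cSUP_least)
      show "{- r..0} \<noteq> {}" using \<open>r > 0\<close> by simp
      fix s assume s: "s \<in> {- r..0}"
      have "v (t + s) \<le> \<phi> (t + s)" using below[of "t + s"] s t by auto
      also have "\<dots> \<le> K * exp (- \<eta> * (t - r))"
        unfolding \<phi>_def using s \<eta>(1) \<open>K > 0\<close> by (auto intro: mult_left_mono)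
      also have "\<dots> = \<phi> t * exp (\<eta> * r)"
        by (simp add: \<phi>_def algebra_simps flip: exp_add)
      finally show "v (t + s) \<le> \<phi> t * exp (\<eta> * r)" .
    qed
    \<comment> \<open>The strictness of the final comparison of slopes comes from here, through
      \<open>M < K\<close> and \<open>\<alpha> > 0\<close>.\<close>
    have "\<alpha> * M * exp (- \<beta> * t) \<le> \<alpha> * M * exp (- \<eta> * t)"
      using \<open>\<alpha> > 0\<close> \<open>M \<ge> 0\<close> \<eta>(2) t(1) by (intro mult_left_mono) (auto intro: mult_right_mono)
    also have "\<dots> < \<alpha> * K * exp (- \<eta> * t)" using \<open>\<alpha> > 0\<close> \<open>M < K\<close> by simp
    also have "\<dots> = \<alpha> * \<phi> t" by (simp add: \<phi>_def)
    finally have forcing: "\<alpha> * M * exp (- \<beta> * t) < \<alpha> * \<phi> t" .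
    have "\<phi> t > 0" using \<open>K > 0\<close> by (simp add: \<phi>_def)
    have "- a * v t + b * (SUP s\<in>{- r..0}. v (t + s)) + \<alpha> * M * exp (- \<beta> * t)
        < - a * \<phi> t + b * (\<phi> t * exp (\<eta> * r)) + \<alpha> * \<phi> t"
      using t(2) forcing mult_left_mono[OF sup, of b] \<open>b > 0\<close> by (simp add: add_le_less_mono)
    also have "\<dots> = \<phi> t * (b * exp (\<eta> * r) + \<alpha> - a)" by (simp add: algebra_simps)
    also have "\<dots> \<le> \<phi> t * (- \<eta>)"
      using \<eta>(3) \<open>\<phi> t > 0\<close> by (intro mult_left_mono) auto
    finally have less: "- a * v t + b * (SUP s\<in>{- r..0}. v (t + s)) + \<alpha> * M * exp (- \<beta> * t)
        < \<phi> t * (- \<eta>)" .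
    have "(\<phi> has_real_derivative \<phi> t * (- \<eta>)) (at t)"
      unfolding \<phi>_def by (auto intro!: derivative_eq_intros)
    from below_after_contact[OF dini[OF t(1), folded M_def] less this] t(2)
    show "\<forall>\<^sub>F h in at_right 0. v (t + h) - \<phi> (t + h) \<le> 0" by simp
  qed
  then show ?thesis by (simp add: \<phi>_def)
qed

theorem lemma1:
  fixes a b \<alpha> \<beta> r :: real and v :: "real \<Rightarrow> real"
  assumes "a > 0" and "b > 0" and "\<alpha> > 0" and "\<beta> > 0" and "r > 0"
    and "a > b + \<alpha>"
    and "continuous_on {- r..} v"
    and "\<And>t. t \<ge> - r \<Longrightarrow> v t \<ge> 0"
    and "\<And>t. t \<ge> 0 \<Longrightarrow>
      dini_upper_right v t \<le>
        ereal (- a * v t + b * (SUP s\<in>{- r..0}. v (t + s))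
               + \<alpha> * initial_norm r v * exp (- \<beta> * t))"
  shows "(\<exists>!l::real. l > 0 \<and> a = b * exp (l * r) + l + \<alpha>) \<and>
    (\<forall>l::real. l > 0 \<and> a = b * exp (l * r) + l + \<alpha> \<longrightarrow>
      (\<forall>t\<ge>0. v t \<le> initial_norm r v * exp (- min l \<beta> * t)))"
proof (intro conjI allI impI)
  show "\<exists>!l::real. l > 0 \<and> a = b * exp (l * r) + l + \<alpha>"
    using assms by (intro characteristic_root_ex1)
next
  fix l t :: real
  assume l: "l > 0 \<and> a = b * exp (l * r) + l + \<alpha>" and "t \<ge> 0"
  define \<eta> where "\<eta> = min l \<beta>"
  \<comment> \<open>Replacing the root \<open>l\<close> by the smaller \<open>\<eta>\<close> can
    only decrease the characteristic expression.\<close>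
  have "exp (\<eta> * r) \<le> exp (l * r)" using \<open>r > 0\<close> by (simp add: \<eta>_def)
  then have "b * exp (\<eta> * r) \<le> b * exp (l * r)" using \<open>b > 0\<close> by simp
  then have \<eta>: "\<eta> \<ge> 0" "\<eta> \<le> \<beta>" "b * exp (\<eta> * r) + \<eta> + \<alpha> \<le> a"
    using l \<open>\<beta> > 0\<close> by (auto simp: \<eta>_def)
  \<comment> \<open>Dividing by the positive exponential isolates \<open>K\<close>, so the bound for
    every larger \<open>K\<close> passes to the infimum.\<close>
  have "v t / exp (- \<eta> * t) \<le> initial_norm r v"
  proof (rule dense_ge)
    fix K assume "initial_norm r v < K"
    from halanay_strict_majorant[OF assms(2,3,5,7-9) \<eta> this \<open>t \<ge> 0\<close>]
    show "v t / exp (- \<eta> * t) \<le> K" by (simp add: divide_le_eq)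
  qed
  then show "v t \<le> initial_norm r v * exp (- min l \<beta> * t)"
    by (simp add: \<eta>_def divide_le_eq)
qed

end
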